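(* Let $(\sigma',u')$ and $(\sigma'',u'')$ be colored permutations. Then $$\mathbf{G}_{\sigma',u'}\,\mathbf{G}_{\sigma'',u''}=\sum_{\sigma\in\sigma'*\sigma''}\mathbf{G}_{\sigma,\,u'\cdot u''},$$ where $u'\cdot u''$ is the concatenation of the color words. Therefore the elements $\mathbf{G}_{\sigma,u}$, over all colored permutations $(\sigma,u)$, span a $\mathbb{Z}$-subalgebra $\mathbf{FQSym}^{(\ell)}$ of the free associative algebra over $\mathbb{Z}$ on the colored alphabet $\boldsymbol{A}=A\times C$.
   Context: Let $C$ be a set of $\ell$ colors, $A=\{1<2<3<\cdots\}$, and $\boldsymbol{A}=A\times C$. A word of length $n$ over $\boldsymbol{A}$ is written as a pair $(v,u)$ with $v\in A^n$, $u\in C^n$; concatenation is done separately on both components. The standardization $\mathrm{Std}(v)\in\mathfrak{S}_n$ of $v\in A^n$ is the permutation having the same inversions as $v$ (number from left to right the occurrences of the smallest letter by $1,2,\ldots$, then continue with the occurrences of the next letter, and so on). The colored standardization of $(v,u)$ is $\mathbf{Std}(v,u)=(\mathrm{Std}(v),u)$. A colored permutation of size $n$ is a pair $(\sigma,u)$ with $\sigma\in\mathfrak{S}_n$, $u\in C^n$. Set $$\mathbf{G}_{\sigma,u}=\sum_{w\in\boldsymbol{A}^n,\ \mathbf{Std}(w)=(\sigma,u)}w,$$ an infinite formal sum of words of length $n$ (as usual, one works in the algebra of formal, possibly infinite, $\mathbb{Z}$-linear combinations of words of bounded degree over $\boldsymbol{A}$). The convolution $\sigma'*\sigma''$ of $\sigma'\in\mathfrak{S}_p$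 and $\sigma''\in\mathfrak{S}_q$ is the set of all $\tau\in\mathfrak{S}_{p+q}$ such that the standardization of the word of the first $p$ letters of $\tau$ is $\sigma'$ and the standardization of the word of the last $q$ letters of $\tau$ is $\sigma''$. *)

theory Defs
  imports "HOL-Algebra.Subrings" "HOL-Combinatorics.Multiset_Permutations"
begin

section \<open>Standardization\<close>

definition inversions :: "nat list \<Rightarrow> (nat \<times> nat) set" where
  "inversions v = {(i, j). i < j \<and> j < length v \<and> v ! i > v ! j}"

text \<open>Permutations of size \<open>n\<close> are written in one-line notation, as words in the letters
  \<open>1, \<dots>, n\<close>. Positions in words are counted from \<open>0\<close>.\<close>

abbreviation perms :: "nat \<Rightarrow> nat list set" where
  "perms n \<equiv> permutations_of_set {1..n}"

definition Std :: "nat list \<Rightarrow> nat list" where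
  "Std v = (THE \<sigma>. \<sigma> \<in> perms (length v) \<and> inversions \<sigma> = inversions v)"

text \<open>The number given to position \<open>i\<close> when the occurrences of the smallest letter are numbered
  from left to right, then those of the next letter, and so on. Lemma \<open>Std_eq\<close> below shows that
  this computes the standardization.\<close>

definition std_rank :: "nat list \<Rightarrow> nat \<Rightarrow> nat" where
  "std_rank v i = card {j. j < length v \<and> (v ! j < v ! i \<or> v ! j = v ! i \<and> j \<le> i)}"

lemma length_perms: "\<sigma> \<in> perms n \<Longrightarrow> length \<sigma> = n"
  by (metis card_atLeastAtMost diff_Suc_1 length_finite_permutations_of_set)

lemma perm_nth_conv_inversions:
  assumes "\<sigma> \<in> perms n" "i < n"
  shows "\<sigma> ! i = card {j. j < n \<and> (if j \<le> i then (j, i) \<notin> inversions \<sigma> else (i, j) \<in> inversions \<sigma>)}"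
proof -
  have len: "length \<sigma> = n" using assms(1) by (rule length_perms)
  have d: "distinct \<sigma>" and s: "set \<sigma> = {1..n}"
    using assms(1) by (auto simp: permutations_of_set_def)
  have eq: "{j. j < n \<and> (if j \<le> i then (j, i) \<notin> inversions \<sigma> else (i, j) \<in> inversions \<sigma>)}
      = {j. j < n \<and> \<sigma> ! j \<le> \<sigma> ! i}"
    using d len assms(2) by (auto simp: inversions_def nth_eq_iff_index_eq order_less_le)
  have "(\<lambda>j. \<sigma> ! j) ` {j. j < n \<and> \<sigma> ! j \<le> \<sigma> ! i} = {x \<in> set \<sigma>. x \<le> \<sigma> ! i}"
    using len by (auto simp: set_conv_nth image_iff)
  also have "\<dots> = {1..\<sigma> ! i}"
  proof -
    have "\<sigma> ! i \<in> set \<sigma>" using len assms(2) by simp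
    then show ?thesis using s by auto
  qed
  finally have im: "(\<lambda>j. \<sigma> ! j) ` {j. j < n \<and> \<sigma> ! j \<le> \<sigma> ! i} = {1..\<sigma> ! i}" .
  have "inj_on (\<lambda>j. \<sigma> ! j) {j. j < n \<and> \<sigma> ! j \<le> \<sigma> ! i}"
    using d len by (auto simp: inj_on_def nth_eq_iff_index_eq)
  from card_image[OF this] im eq show ?thesis by simp
qed

lemma perms_eq_if_inversions_eq:
  assumes "\<sigma> \<in> perms n" "\<tau> \<in> perms n" "inversions \<sigma> = inversions \<tau>"
  shows "\<sigma> = \<tau>"
  using assms by (intro nth_equalityI)
    (simp_all add: length_perms perm_nth_conv_inversions[of _ n])

lemma std_rank_less:
  assumes "i < length v" "k < length v" "v ! i < v ! k \<or> v ! i = v ! k \<and> i < k"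
  shows "std_rank v i < std_rank v k"
  unfolding std_rank_def
proof (rule psubset_card_mono)
  have "k \<in> {j. j < length v \<and> (v ! j < v ! k \<or> v ! j = v ! k \<and> j \<le> k)}"
    using assms by auto
  moreover have "k \<notin> {j. j < length v \<and> (v ! j < v ! i \<or> v ! j = v ! i \<and> j \<le> i)}"
    using assms by auto
  ultimately show "{j. j < length v \<and> (v ! j < v ! i \<or> v ! j = v ! i \<and> j \<le> i)}
    \<subset> {j. j < length v \<and> (v ! j < v ! k \<or> v ! j = v ! k \<and> j \<le> k)}"
    using assms by auto
qed simp

lemma std_rank_perm:
  defines "s \<equiv> \<lambda>v. map (std_rank v) [0..<length v]"
  shows "s v \<in> perms (length v)" "inversions (s v) = inversions v"
proof -
  have inj: "inj_on (std_rank v) {0..<length v}"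
    by (rule inj_onI, rule ccontr)
      (metis atLeastLessThan_iff less_irrefl linorder_neqE_nat std_rank_less)
  have bounds: "std_rank v i \<in> {1..length v}" if "i < length v" for i
  proof -
    have "std_rank v i \<le> card {..<length v}"
      unfolding std_rank_def by (rule card_mono) auto
    moreover have "std_rank v i > 0"
      unfolding std_rank_def using that by (subst card_gt_0_iff) auto
    ultimately show ?thesis by simp
  qed
  have "std_rank v ` {0..<length v} = {1..length v}"
    by (rule card_subset_eq) (use bounds in \<open>auto simp: card_image[OF inj]\<close>)
  then show "s v \<in> perms (length v)"
    using inj by (simp add: s_def permutations_of_set_def distinct_map)
  have "std_rank v j < std_rank v i \<longleftrightarrow> v ! j < v ! i" if "i < j" "j < length v" for i j
    using that std_rank_less[of i v j] std_rank_less[of j v i]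
    by (meson less_asym less_trans linorder_neqE_nat)
  then show "inversions (s v) = inversions v"
    by (auto simp: s_def inversions_def)
qed

lemma Std_eq: "Std v = map (std_rank v) [0..<length v]"
  unfolding Std_def
  by (rule the_equality) (use std_rank_perm perms_eq_if_inversions_eq in metis)+

lemma Std_in_perms: "Std v \<in> perms (length v)"
  and inversions_Std: "inversions (Std v) = inversions v"
  using std_rank_perm by (simp_all add: Std_eq)

definition convolution :: "nat list \<Rightarrow> nat list \<Rightarrow> nat list set" where
  "convolution \<sigma>' \<sigma>'' = {\<tau> \<in> perms (length \<sigma>' + length \<sigma>'').
     Std (take (length \<sigma>') \<tau>) = \<sigma>' \<and> Std (drop (length \<sigma>') \<tau>) = \<sigma>''}"


section \<open>Colored words\<close>

text \<open>A word over \<open>A \<times> C\<close> is a list of colored letters; in the notation \<open>(v, u)\<close> it has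
  \<open>v = map fst w\<close> and \<open>u = map snd w\<close>, and concatenation is list concatenation.\<close>

type_synonym 'c cword = "(nat \<times> 'c) list"

definition letters :: "nat set" where
  "letters = {1..}"

abbreviation cwords :: "'c set \<Rightarrow> 'c cword set" where
  "cwords C \<equiv> lists (letters \<times> C)"

definition cStd :: "'c cword \<Rightarrow> nat list \<times> 'c list" where
  "cStd w = (Std (map fst w), map snd w)"

definition colored_perms :: "'c set \<Rightarrow> nat \<Rightarrow> (nat list \<times> 'c list) set" where
  "colored_perms C n = perms n \<times> {u \<in> lists C. length u = n}"


section \<open>Formal sums of words of bounded degree\<close>

text \<open>A formal sum is given by its coefficient function.\<close>

definition formal_sums :: "'c set \<Rightarrow> ('c cword \<Rightarrow> int) set" where
  "formal_sums C = {f. (\<forall>w. f w \<noteq> 0 \<longrightarrow> w \<in> cwords C) \<and> (\<exists>d. \<forall>w. f w \<noteq> 0 \<longrightarrow> length w \<le> d)}"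

definition word_algebra :: "'c set \<Rightarrow> ('c cword \<Rightarrow> int) ring" where
  "word_algebra C = \<lparr>carrier = formal_sums C,
     monoid.mult = (\<lambda>f g w. \<Sum>(x, y) | x @ y = w. f x * g y),
     one = (\<lambda>w. if w = [] then 1 else 0),
     zero = (\<lambda>w. 0),
     add = (\<lambda>f g w. f w + g w)\<rparr>"

lemma word_algebra_simps:
  "carrier (word_algebra C) = formal_sums C"
  "f \<otimes>\<^bsub>word_algebra C\<^esub> g = (\<lambda>w. \<Sum>(x, y) | x @ y = w. f x * g y)"
  "\<one>\<^bsub>word_algebra C\<^esub> = (\<lambda>w. if w = [] then 1 else 0)"
  "\<zero>\<^bsub>word_algebra C\<^esub> = (\<lambda>w. 0)"
  "f \<oplus>\<^bsub>word_algebra C\<^esub> g = (\<lambda>w. f w + g w)"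
  by (simp_all add: word_algebra_def)

lemma finite_splits: "finite {(x, y). x @ y = w}"
proof (rule finite_subset)
  show "{(x, y). x @ y = w} \<subseteq> (\<lambda>i. (take i w, drop i w)) ` {..length w}"
  proof clarify
    fix x y assume "w = x @ y"
    then show "(x, y) \<in> (\<lambda>i. (take i (x @ y), drop i (x @ y))) ` {..length (x @ y)}"
      by (intro image_eqI[of _ _ "length x"]) auto
  qed
qed simp

lemma formal_sums_add:
  assumes "f \<in> formal_sums C" "g \<in> formal_sums C"
  shows "(\<lambda>w. f w + g w) \<in> formal_sums C"
proof -
  obtain d e where "\<forall>w. f w \<noteq> 0 \<longrightarrow> length w \<le> d" "\<forall>w. g w \<noteq> 0 \<longrightarrow> length w \<le> e"
    using assms by (auto simp: formal_sums_def)
  then have "\<forall>w. f w + g w \<noteq> 0 \<longrightarrow> length w \<le> max d e"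
    by (metis add.right_neutral le_max_iff_disj)
  moreover have "\<forall>w. f w + g w \<noteq> 0 \<longrightarrow> w \<in> cwords C"
    using assms unfolding formal_sums_def mem_Collect_eq by (metis add.right_neutral)
  ultimately show ?thesis unfolding formal_sums_def by blast
qed

lemma formal_sums_mult:
  assumes "f \<in> formal_sums C" "g \<in> formal_sums C"
  shows "(\<lambda>w. \<Sum>(x, y) | x @ y = w. f x * g y) \<in> formal_sums C"
proof -
  obtain d e where de: "\<forall>w. f w \<noteq> 0 \<longrightarrow> length w \<le> d" "\<forall>w. g w \<noteq> 0 \<longrightarrow> length w \<le> e"
    using assms by (auto simp: formal_sums_def)
  have "w \<in> cwords C \<and> length w \<le> d + e" if nz: "(\<Sum>(x, y) | x @ y = w. f x * g y) \<noteq> 0" for w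
  proof -
    have "\<exists>x y. x @ y = w \<and> f x * g y \<noteq> 0"
    proof (rule ccontr)
      assume "\<nexists>x y. x @ y = w \<and> f x * g y \<noteq> 0"
      then have "(\<Sum>(x, y) | x @ y = w. f x * g y) = 0"
        by (intro sum.neutral) auto
      with nz show False by simp
    qed
    then obtain x y where xy: "x @ y = w" "f x \<noteq> 0" "g y \<noteq> 0" by auto
    then have "x \<in> cwords C" "y \<in> cwords C"
      using assms by (auto simp: formal_sums_def)
    moreover have "length x \<le> d" "length y \<le> e" using xy de by auto
    ultimately show ?thesis using xy(1) by auto
  qed
  then show ?thesis unfolding formal_sums_def by blast
qed

lemma word_mult_assoc:
  fixes f g h :: "'a list \<Rightarrow> int"
  shows "(\<Sum>(x, z) | x @ z = w. (\<Sum>(p, q) | p @ q = x. f p * g q) * h z)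
       = (\<Sum>(p, y) | p @ y = w. f p * (\<Sum>(q, z) | q @ z = y. g q * h z))"
proof -
  have "(\<Sum>(x, z) | x @ z = w. (\<Sum>(p, q) | p @ q = x. f p * g q) * h z)
      = (\<Sum>s\<in>{(x, z). x @ z = w}. \<Sum>t\<in>{(p, q). p @ q = fst s}. f (fst t) * g (snd t) * h (snd s))"
    by (simp add: sum_distrib_right case_prod_unfold)
  also have "\<dots> = (\<Sum>(s, t)\<in>(SIGMA s:{(x, z). x @ z = w}. {(p, q). p @ q = fst s}).
      f (fst t) * g (snd t) * h (snd s))"
    by (subst sum.Sigma) (auto intro: finite_splits)
  also have "\<dots> = (\<Sum>(s, t)\<in>(SIGMA s:{(p, y). p @ y = w}. {(q, z). q @ z = snd s}).
      f (fst s) * (g (fst t) * h (snd t)))"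
    by (rule sum.reindex_bij_witness[where
        i = "\<lambda>((p, y), (q, z)). ((p @ q, z), (p, q))" and
        j = "\<lambda>((x, z), (p, q)). ((p, q @ z), (q, z))"]) (auto simp: mult.assoc)
  also have "\<dots> = (\<Sum>s\<in>{(p, y). p @ y = w}. \<Sum>t\<in>{(q, z). q @ z = snd s}.
      f (fst s) * (g (fst t) * h (snd t)))"
    by (subst sum.Sigma) (auto intro: finite_splits)
  also have "\<dots> = (\<Sum>(p, y) | p @ y = w. f p * (\<Sum>(q, z) | q @ z = y. g q * h z))"
    by (simp add: sum_distrib_left case_prod_unfold)
  finally show ?thesis .
qed

lemma word_mult_one:
  fixes f :: "'a list \<Rightarrow> int"
  shows "(\<Sum>(x, y) | x @ y = w. (if x = [] then 1 else 0) * f y) = f w"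
    and "(\<Sum>(x, y) | x @ y = w. f x * (if y = [] then 1 else 0)) = f w"
proof -
  have "(\<Sum>(x, y) | x @ y = w. (if x = [] then 1 else 0) * f y)
      = (\<Sum>(x, y)\<in>{([] :: 'a list, w)}. (if x = [] then 1 else 0) * f y)"
    by (rule sum.mono_neutral_right) (auto intro: finite_splits split: if_splits)
  then show "(\<Sum>(x, y) | x @ y = w. (if x = [] then 1 else 0) * f y) = f w" by simp
  have "(\<Sum>(x, y) | x @ y = w. f x * (if y = [] then 1 else 0))
      = (\<Sum>(x, y)\<in>{(w, [] :: 'a list)}. f x * (if y = [] then 1 else 0))"
    by (rule sum.mono_neutral_right) (auto intro: finite_splits split: if_splits)
  then show "(\<Sum>(x, y) | x @ y = w. f x * (if y = [] then 1 else 0)) = f w" by simp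
qed

lemma ring_word_algebra: "ring (word_algebra C)"
proof (rule ringI)
  show "abelian_group (word_algebra C)"
  proof (rule abelian_groupI)
    fix f assume "f \<in> carrier (word_algebra C)"
    then have "(\<lambda>w. - f w) \<in> formal_sums C"
      by (simp add: word_algebra_simps formal_sums_def)
    then show "\<exists>g\<in>carrier (word_algebra C). g \<oplus>\<^bsub>word_algebra C\<^esub> f = \<zero>\<^bsub>word_algebra C\<^esub>"
      by (intro bexI[of _ "\<lambda>w. - f w"]) (simp_all add: word_algebra_simps)
  qed (auto simp: word_algebra_simps formal_sums_add add_ac, simp add: formal_sums_def)
  show "monoid (word_algebra C)"
  proof (rule monoidI)
    show "\<one>\<^bsub>word_algebra C\<^esub> \<in> carrier (word_algebra C)"
      by (auto simp: word_algebra_simps formal_sums_def)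
  qed (simp_all add: word_algebra_simps formal_sums_mult word_mult_assoc word_mult_one)
qed (simp_all add: word_algebra_simps case_prod_unfold algebra_simps sum.distrib)

text \<open>The ring multiples \<open>[k] \<cdot> f\<close> of HOL-Algebra are the coefficientwise integer multiples.\<close>

lemma word_algebra_scale:
  assumes f: "f \<in> formal_sums C"
  shows "[(k::int)] \<cdot>\<^bsub>word_algebra C\<^esub> f = (\<lambda>w. k * f w)"
proof -
  interpret R: ring "word_algebra C" by (rule ring_word_algebra)
  have nat: "[(n::nat)] \<cdot>\<^bsub>word_algebra C\<^esub> f = (\<lambda>w. int n * f w)" for n
    by (induction n) (simp_all add: word_algebra_simps algebra_simps)
  have neg: "\<ominus>\<^bsub>word_algebra C\<^esub> g = (\<lambda>w. - g w)" if "g \<in> formal_sums C" for g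
    by (rule R.minus_equality)
      (use that in \<open>auto simp: word_algebra_simps formal_sums_def\<close>)
  have "(\<lambda>w. - (k * f w)) \<in> formal_sums C"
    using f by (auto simp: formal_sums_def)
  then show ?thesis
    by (cases "k \<ge> 0") (simp_all add: add_pow_int_ge add_pow_int_lt nat neg)
qed


section \<open>Integral spans and subalgebras\<close>

definition Z_span :: "('a, 'b) ring_scheme \<Rightarrow> 'a set \<Rightarrow> 'a set" where
  "Z_span R S = {(\<Oplus>\<^bsub>R\<^esub>g\<in>F. [(a g :: int)] \<cdot>\<^bsub>R\<^esub> g) | F a. finite F \<and> F \<subseteq> S}"

definition Z_subalgebra :: "'a set \<Rightarrow> ('a, 'b) ring_scheme \<Rightarrow> bool" where
  "Z_subalgebra H R \<longleftrightarrow> subring H R \<and> (\<forall>k::int. \<forall>f\<in>H. [k] \<cdot>\<^bsub>R\<^esub> f \<in> H)"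


section \<open>The elements \<open>G\<close> and their span\<close>

definition G :: "'c set \<Rightarrow> nat list \<Rightarrow> 'c list \<Rightarrow> 'c cword \<Rightarrow> int" where
  "G C \<sigma> u = (\<lambda>w. if w \<in> cwords C \<and> length w = length \<sigma> \<and> cStd w = (\<sigma>, u) then 1 else 0)"

lemma G_in_formal_sums: "G C \<sigma> u \<in> formal_sums C"
  by (auto simp: G_def formal_sums_def)

definition FQSym :: "'c set \<Rightarrow> ('c cword \<Rightarrow> int) set" where
  "FQSym C = Z_span (word_algebra C) {G C \<sigma> u | \<sigma> u. \<exists>n. (\<sigma>, u) \<in> colored_perms C n}"

end

theory Submission
  imports Defs
begin

text \<open>A standardization is determined by the length and the inversions of the word, and the
  inversions of a prefix or suffix are a restriction of those of the whole word. Hence cutting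
  \<open>Std v\<close> at position \<open>p\<close> and restandardizing gives the standardizations of the two parts of \<open>v\<close>.
  Since the factors of the product are homogeneous, every word has only one relevant splitting, so
  both sides of the product formula are the indicator function of the same set of words.\<close>

section \<open>Integral spans in a ring and a criterion for being a subalgebra\<close>

context ring
begin

lemma Z_span_subset_carrier: "S \<subseteq> carrier R \<Longrightarrow> Z_span R S \<subseteq> carrier R"
  unfolding Z_span_def by (auto intro!: finsum_closed)

lemma zero_in_Z_span: "\<zero> \<in> Z_span R S"
  unfolding Z_span_def by (auto intro!: exI[of _ "{}"])

text \<open>An element of the span is given by one coefficient per generator, so a new multiple of
  \<open>g\<close> has to be merged with the old coefficient of \<open>g\<close>. Splitting
  \<open>g\<close> off from \<open>F\<close> treats old and new generators alike.\<close>

lemma Z_span_add_multiple: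
  assumes S: "S \<subseteq> carrier R" and x: "x \<in> Z_span R S" and g: "g \<in> S"
  shows "x \<oplus> [(k::int)] \<cdot> g \<in> Z_span R S"
proof -
  obtain F and a :: "'a \<Rightarrow> int" where F: "finite F" "F \<subseteq> S" and x: "x = (\<Oplus>h\<in>F. [a h] \<cdot> h)"
    using x by (auto simp: Z_span_def)
  \<comment> \<open>\<open>b\<close> is the true coefficient of \<open>g\<close> in
    \<open>x\<close>: outside \<open>F\<close> the value \<open>a g\<close> is arbitrary and must be
    replaced by 0. The new coefficients \<open>c\<close> differ from \<open>a\<close> only at
    \<open>g\<close>, so the rest \<open>y\<close> of the sum is unaffected.\<close>
  define b where "b = (if g \<in> F then a g else 0)"
  define c where "c = a(g := b + k)"
  define y where "y = (\<Oplus>h\<in>F - {g}. [a h] \<cdot> h)"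
  have gc: "g \<in> carrier R" and yc: "y \<in> carrier R"
    using S F g by (auto simp: y_def intro!: finsum_closed)
  have x': "x = [b] \<cdot> g \<oplus> y"
  proof (cases "g \<in> F")
    case True
    then have "x = (\<Oplus>h\<in>insert g (F - {g}). [a h] \<cdot> h)" by (simp add: x insert_absorb)
    also have "\<dots> = [a g] \<cdot> g \<oplus> y"
      unfolding y_def using S F g by (subst finsum_insert) auto
    finally show ?thesis using True by (simp add: b_def)
  qed (use gc yc x in \<open>simp add: b_def y_def add_pow_int_ge\<close>)
  have "(\<Oplus>h\<in>insert g (F - {g}). [c h] \<cdot> h)
      = [(b + k)] \<cdot> g \<oplus> (\<Oplus>h\<in>F - {g}. [c h] \<cdot> h)"
    using S F g by (subst finsum_insert) (auto simp: c_def)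
  also have "(\<Oplus>h\<in>F - {g}. [c h] \<cdot> h) = y"
    unfolding y_def using S F by (intro finsum_cong') (auto simp: c_def)
  also have "[(b + k)] \<cdot> g \<oplus> y = x \<oplus> [k] \<cdot> g"
    using gc yc by (simp add: x' add.int_pow_mult a_ac)
  finally show ?thesis
    using F g unfolding Z_span_def
    by (intro CollectI exI[of _ "insert g (F - {g})"] exI[of _ c]) auto
qed

text \<open>A finite combination is built from zero by adding one multiple of a generator at a time.
  The \<open>add\<close> case also provides membership in the span, from which the closure proofs
  below obtain membership in the carrier.\<close>

lemma Z_span_induct [consumes 2, case_names zero add]:
  assumes S: "S \<subseteq> carrier R" and x: "x \<in> Z_span R S"
    and zero: "P \<zero>"
    and add: "\<And>x g (k::int). x \<in> Z_span R S \<Longrightarrow> P x \<Longrightarrow> g \<in> S \<Longrightarrow> P (x \<oplus> [k] \<cdot> g)"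
  shows "P x"
proof -
  obtain F and a :: "'a \<Rightarrow> int" where F: "finite F" "F \<subseteq> S" and x: "x = (\<Oplus>h\<in>F. [a h] \<cdot> h)"
    using x by (auto simp: Z_span_def)
  from F have "P (\<Oplus>h\<in>F. [a h] \<cdot> h)"
  proof (induction F)
    case empty
    show ?case using zero by simp
  next
    case (insert g F)
    have "(\<Oplus>h\<in>insert g F. [a h] \<cdot> h) = (\<Oplus>h\<in>F. [a h] \<cdot> h) \<oplus> [a g] \<cdot> g"
      using insert.hyps insert.prems S by (subst finsum_insert) (auto intro!: a_comm finsum_closed)
    moreover have "(\<Oplus>h\<in>F. [a h] \<cdot> h) \<in> Z_span R S"
      using insert.hyps insert.prems by (auto simp: Z_span_def)
    ultimately show ?case using insert add by simp
  qed
  then show ?thesis using x by simp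
qed

lemma generator_in_Z_span:
  assumes "S \<subseteq> carrier R" "g \<in> S"
  shows "g \<in> Z_span R S"
  using Z_span_add_multiple[OF assms(1) zero_in_Z_span assms(2), of 1] assms
  by auto

text \<open>Adding the terms of \<open>y\<close> to \<open>x\<close> one by one avoids merging two
  coefficient functions with different index sets.\<close>

lemma Z_span_add:
  assumes S: "S \<subseteq> carrier R" and x: "x \<in> Z_span R S" and y: "y \<in> Z_span R S"
  shows "x \<oplus> y \<in> Z_span R S"
  using S y
proof (induction rule: Z_span_induct)
  case zero
  show ?case using x Z_span_subset_carrier[OF S] by auto
next
  case (add y g k)
  have "x \<oplus> (y \<oplus> [k] \<cdot> g) = (x \<oplus> y) \<oplus> [k] \<cdot> g"
    using x add S Z_span_subset_carrier[OF S] by (auto simp: a_assoc subset_iff)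
  then show ?case using Z_span_add_multiple[OF S add.IH add.hyps(2)] by simp
qed

lemma Z_span_scale:
  assumes S: "S \<subseteq> carrier R" and x: "x \<in> Z_span R S"
  shows "[(k::int)] \<cdot> x \<in> Z_span R S"
  using S x
proof (induction rule: Z_span_induct)
  case zero
  show ?case by (simp add: zero_in_Z_span)
next
  case (add x g m)
  have "[k] \<cdot> (x \<oplus> [m] \<cdot> g) = [k] \<cdot> x \<oplus> [(m * k)] \<cdot> g"
    using add S Z_span_subset_carrier[OF S]
    by (auto simp: add.int_pow_distrib add.int_pow_pow subset_iff mult.commute)
  then show ?case using Z_span_add_multiple[OF S add.IH add.hyps(2)] by simp
qed

lemma Z_span_finsum:
  assumes S: "S \<subseteq> carrier R" and f: "\<And>i. i \<in> I \<Longrightarrow> f i \<in> Z_span R S"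
  shows "(\<Oplus>i\<in>I. f i) \<in> Z_span R S"
proof (cases "finite I")
  case True
  then show ?thesis using f
  proof (induction I)
    case (insert i I)
    then show ?case
      using Z_span_add[OF S] Z_span_subset_carrier[OF S] by (subst finsum_insert) auto
  qed (simp add: zero_in_Z_span)
\<comment> \<open>Over an infinite index set the sum is zero by convention.\<close>
qed (simp add: zero_in_Z_span)

text \<open>Multiplication is biadditive and compatible with integer multiples, so closure under
  products reduces to products of generators.\<close>

lemma Z_subalgebra_Z_span:
  assumes S: "S \<subseteq> carrier R" and one: "\<one> \<in> Z_span R S"
    and mult: "\<And>g h. g \<in> S \<Longrightarrow> h \<in> S \<Longrightarrow> g \<otimes> h \<in> Z_span R S"
  shows "Z_subalgebra (Z_span R S) R"
proof -
  note carr = Z_span_subset_carrier[OF S, THEN subsetD]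
  \<comment> \<open>Biadditivity is used one factor at a time: first the left factor varies while
    the right one is a generator, then the right factor varies too.\<close>
  have right: "x \<otimes> h \<in> Z_span R S" if "x \<in> Z_span R S" "h \<in> S" for x h
    using S that(1)
  proof (induction rule: Z_span_induct)
    case zero
    show ?case using that S by (auto simp: zero_in_Z_span)
  next
    case (add x g k)
    have "(x \<oplus> [k] \<cdot> g) \<otimes> h = x \<otimes> h \<oplus> [k] \<cdot> (g \<otimes> h)"
      using add.hyps that(2) S carr by (auto simp: l_distr add_pow_ldistr_int subset_iff)
    then show ?case
      using Z_span_add[OF S add.IH] Z_span_scale[OF S] mult add.hyps(2) that(2) by simp
  qed
  have "x \<otimes> y \<in> Z_span R S" if "x \<in> Z_span R S" "y \<in> Z_span R S" for x y
    using S that(2)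
  proof (induction rule: Z_span_induct)
    case zero
    show ?case using carr[OF that(1)] by (simp add: zero_in_Z_span)
  next
    case (add y h k)
    have "x \<otimes> (y \<oplus> [k] \<cdot> h) = x \<otimes> y \<oplus> [k] \<cdot> (x \<otimes> h)"
      using add.hyps that(1) S carr by (auto simp: r_distr add_pow_rdistr_int subset_iff)
    then show ?case
      using Z_span_add[OF S add.IH] Z_span_scale[OF S] right[OF that(1) add.hyps(2)] by simp
  qed
  moreover have "\<ominus> x \<in> Z_span R S" if "x \<in> Z_span R S" for x
  proof -
    \<comment> \<open>Closure under negation is the case \<open>- 1\<close> of closure under integer
      multiples.\<close>
    have "[(- 1::int)] \<cdot> x = \<ominus> x"
      using carr[OF that] by (simp only: add.int_pow_neg add.int_pow_1)
    then show ?thesis using Z_span_scale[OF S that, of "- 1"] by simp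
  qed
  ultimately have "subring (Z_span R S) R"
    using Z_span_add[OF S] one Z_span_subset_carrier[OF S] by (intro subringI) auto
  then show ?thesis using Z_span_scale[OF S] by (simp add: Z_subalgebra_def)
qed

end

section \<open>Standardization of prefixes and suffixes\<close>

lemma length_Std [simp]: "length (Std v) = length v"
  using Std_in_perms by (rule length_perms)

lemma Std_in_perms_iff: "Std v \<in> perms n \<longleftrightarrow> length v = n"
  using Std_in_perms[of v] length_perms[of "Std v" n] by auto

text \<open>\<open>Std v\<close> is the only permutation of size \<open>length v\<close> with the
  inversions of \<open>v\<close>. The length is separate information: weakly increasing words of
  every length have no inversions.\<close>

lemma Std_eq_iff:
  "Std v = Std w \<longleftrightarrow> length v = length w \<and> inversions v = inversions w"
proof
  assume eq: "Std v = Std w"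
  show "length v = length w \<and> inversions v = inversions w"
    using arg_cong[OF eq, of length] arg_cong[OF eq, of inversions] by (simp add: inversions_Std)
next
  assume "length v = length w \<and> inversions v = inversions w"
  then show "Std v = Std w"
    by (intro perms_eq_if_inversions_eq[of _ "length v"]) (simp_all add: Std_in_perms_iff inversions_Std del: One_nat_def)
qed

text \<open>Bounding \<open>j\<close> is enough, since \<open>i < j\<close> in every
  inversion.\<close>

lemma inversions_take: "inversions (take p v) = {(i, j) \<in> inversions v. j < p}"
  by (auto simp: inversions_def)

lemma inversions_drop: "inversions (drop p v) = {(i, j). (p + i, p + j) \<in> inversions v}"
  by (auto simp: inversions_def add.commute less_diff_conv)

lemma Std_take_Std: "Std (take p (Std v)) = Std (take p v)"
  by (simp add: Std_eq_iff inversions_take inversions_Std)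

lemma Std_drop_Std: "Std (drop p (Std v)) = Std (drop p v)"
  by (simp add: Std_eq_iff inversions_drop inversions_Std)

text \<open>The cuts of \<open>Std v\<close> in the definition of \<open>convolution\<close> may be
  replaced by cuts of \<open>v\<close> itself. This turns the index set of the product formula into
  a condition on the two factors of a word.\<close>

lemma Std_in_convolution_iff:
  "Std v \<in> convolution \<sigma>' \<sigma>'' \<longleftrightarrow> length v = length \<sigma>' + length \<sigma>'' \<and>
     Std (take (length \<sigma>') v) = \<sigma>' \<and> Std (drop (length \<sigma>') v) = \<sigma>''"
  by (simp add: convolution_def Std_in_perms_iff Std_take_Std Std_drop_Std del: One_nat_def)

section \<open>The product formula, coefficient by coefficient\<close>

lemma finsum_word_algebra:
  assumes "finite I" "\<And>i. i \<in> I \<Longrightarrow> f i \<in> formal_sums C"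
  shows "(\<Oplus>\<^bsub>word_algebra C\<^esub>i\<in>I. f i) = (\<lambda>w. \<Sum>i\<in>I. f i w)"
proof -
  interpret R: ring "word_algebra C" by (rule ring_word_algebra)
  show ?thesis using assms
  proof (induction I)
    case (insert i I)
    then show ?case
      by (subst R.finsum_insert) (auto simp: word_algebra_simps)
  qed (simp add: word_algebra_simps)
qed

text \<open>Homogeneity of \<open>f\<close> leaves only the splitting after \<open>p\<close>
  letters. If \<open>w\<close> is shorter than \<open>p\<close>, then \<open>take p w\<close> is
  \<open>w\<close>, where \<open>f\<close> vanishes, and both sides are 0.\<close>

lemma word_mult_at_length:
  fixes f g :: "'a list \<Rightarrow> int"
  assumes "\<And>x. f x \<noteq> 0 \<Longrightarrow> length x = p"
  shows "(\<Sum>(x, y) | x @ y = w. f x * g y) = f (take p w) * g (drop p w)"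
proof -
  have "(\<Sum>(x, y) | x @ y = w. f x * g y) = (\<Sum>(x, y)\<in>{(take p w, drop p w)}. f x * g y)"
    by (rule sum.mono_neutral_right) (use assms in \<open>auto intro: finite_splits\<close>)
  then show ?thesis by simp
qed

lemma length_colored_perms:
  assumes "(\<sigma>, u) \<in> colored_perms C n"
  shows "length \<sigma> = n" "length u = n"
  using assms length_perms[of \<sigma> n] by (auto simp: colored_perms_def)

lemma G_mult:
  assumes "(\<sigma>', u') \<in> colored_perms C p" "(\<sigma>'', u'') \<in> colored_perms C q"
  shows "G C \<sigma>' u' \<otimes>\<^bsub>word_algebra C\<^esub> G C \<sigma>'' u''
    = (\<Oplus>\<^bsub>word_algebra C\<^esub>\<sigma>\<in>convolution \<sigma>' \<sigma>''. G C \<sigma> (u' @ u''))"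
proof -
  have len: "length \<sigma>' = p" "length u' = p" "length \<sigma>'' = q"
    using assms by (simp_all add: length_colored_perms)
  \<comment> \<open>Finiteness ensures that the sum in the algebra is a genuine sum and not its
    default value zero.\<close>
  have fin: "finite (convolution \<sigma>' \<sigma>'')"
    by (simp add: convolution_def)
  have "G C \<sigma>' u' (take p w) * G C \<sigma>'' u'' (drop p w)
      = (\<Sum>\<sigma>\<in>convolution \<sigma>' \<sigma>''. G C \<sigma> (u' @ u'') w)" for w
  proof -
    \<comment> \<open>For fixed \<open>w\<close> only \<sigma> = \<open>Std (map fst w)\<close> can
      contribute, so the sum over the convolution collapses to at most one term. The length
      condition in \<open>G\<close> is absorbed because \<open>Std\<close> preserves length.\<close>
    have G: "G C \<sigma> (u' @ u'') w
        = (if \<sigma> = Std (map fst w) then (if w \<in> cwords C \<and> map snd w = u' @ u'' then 1 else 0) else 0)"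
      for \<sigma>
      by (auto simp: G_def cStd_def)
    have cw: "w \<in> cwords C \<longleftrightarrow> take p w \<in> cwords C \<and> drop p w \<in> cwords C"
      by (metis append_in_lists_conv append_take_drop_id)
    \<comment> \<open>The color word splits at \<open>p\<close> because \<open>u'\<close> has length
      \<open>p\<close>.\<close>
    have cols: "map snd w = u' @ u'' \<longleftrightarrow> map snd (take p w) = u' \<and> map snd (drop p w) = u''"
      using len by (metis append_eq_conv_conj drop_map take_map)
    have "(\<Sum>\<sigma>\<in>convolution \<sigma>' \<sigma>''. G C \<sigma> (u' @ u'') w)
        = (if Std (map fst w) \<in> convolution \<sigma>' \<sigma>'' \<and> w \<in> cwords C \<and> map snd w = u' @ u''
           then 1 else 0)"
      unfolding G using fin by simp
    also have "\<dots> = G C \<sigma>' u' (take p w) * G C \<sigma>'' u'' (drop p w)"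
      unfolding Std_in_convolution_iff cw cols
      by (auto simp: G_def cStd_def len take_map drop_map)
    finally show ?thesis by simp
  qed
  moreover have "(\<Sum>(x, y) | x @ y = w. G C \<sigma>' u' x * G C \<sigma>'' u'' y)
      = G C \<sigma>' u' (take p w) * G C \<sigma>'' u'' (drop p w)" for w
    by (rule word_mult_at_length) (auto simp: G_def len split: if_splits)
  ultimately show ?thesis
    using fin by (simp add: word_algebra_simps finsum_word_algebra G_in_formal_sums)
qed

section \<open>Closure of the span under multiplication, and its unit\<close>

lemma convolution_colored_perms:
  assumes "(\<sigma>', u') \<in> colored_perms C p" "(\<sigma>'', u'') \<in> colored_perms C q"
    and "\<sigma> \<in> convolution \<sigma>' \<sigma>''"
  shows "(\<sigma>, u' @ u'') \<in> colored_perms C (p + q)"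
proof -
  have "length \<sigma>' = p" "length \<sigma>'' = q"
    using assms(1,2) by (simp_all add: length_colored_perms)
  then show ?thesis using assms by (simp add: colored_perms_def convolution_def)
qed

text \<open>Only the empty word standardizes to the empty permutation, so the unit is itself one of
  the generators, in size 0.\<close>

lemma G_Nil: "G C [] [] = \<one>\<^bsub>word_algebra C\<^esub>"
  by (auto simp: G_def cStd_def Std_eq word_algebra_simps)

theorem theorem3p2:
  fixes C :: "'c set" and l :: nat
  assumes "finite C" and "card C = l"
  shows "(\<forall>p q \<sigma>' u' \<sigma>'' u''.
            (\<sigma>', u') \<in> colored_perms C p \<longrightarrow> (\<sigma>'', u'') \<in> colored_perms C q \<longrightarrow>
            G C \<sigma>' u' \<otimes>\<^bsub>word_algebra C\<^esub> G C \<sigma>'' u''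
              = (\<Oplus>\<^bsub>word_algebra C\<^esub>\<sigma>\<in>convolution \<sigma>' \<sigma>''. G C \<sigma> (u' @ u'')))
         \<and> Z_subalgebra (FQSym C) (word_algebra C)"
proof (intro conjI allI impI)
  fix p q \<sigma>' u' \<sigma>'' u''
  assume "(\<sigma>', u') \<in> colored_perms C p" "(\<sigma>'', u'') \<in> colored_perms C q"
  then show "G C \<sigma>' u' \<otimes>\<^bsub>word_algebra C\<^esub> G C \<sigma>'' u''
      = (\<Oplus>\<^bsub>word_algebra C\<^esub>\<sigma>\<in>convolution \<sigma>' \<sigma>''. G C \<sigma> (u' @ u''))"
    by (rule G_mult)
next
  interpret R: ring "word_algebra C" by (rule ring_word_algebra)
  let ?S = "{G C \<sigma> u | \<sigma> u. \<exists>n. (\<sigma>, u) \<in> colored_perms C n}"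
  have S: "?S \<subseteq> carrier (word_algebra C)"
    by (auto simp: word_algebra_simps G_in_formal_sums)
  show "Z_subalgebra (FQSym C) (word_algebra C)"
    unfolding FQSym_def
  proof (rule R.Z_subalgebra_Z_span[OF S])
    have "([], []) \<in> colored_perms C 0" by (simp add: colored_perms_def)
    then have "\<one>\<^bsub>word_algebra C\<^esub> \<in> ?S" unfolding G_Nil[symmetric] by blast
    then show "\<one>\<^bsub>word_algebra C\<^esub> \<in> Z_span (word_algebra C) ?S"
      by (rule R.generator_in_Z_span[OF S])
  next
    fix g h assume "g \<in> ?S" "h \<in> ?S"
    then obtain p q \<sigma>' u' \<sigma>'' u'' where
      gh: "g = G C \<sigma>' u'" "h = G C \<sigma>'' u''"
      and cp: "(\<sigma>', u') \<in> colored_perms C p" "(\<sigma>'', u'') \<in> colored_perms C q"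
      by blast
    have "G C \<sigma> (u' @ u'') \<in> Z_span (word_algebra C) ?S" if "\<sigma> \<in> convolution \<sigma>' \<sigma>''" for \<sigma>
      using convolution_colored_perms[OF cp that] by (intro R.generator_in_Z_span[OF S]) blast
    then show "g \<otimes>\<^bsub>word_algebra C\<^esub> h \<in> Z_span (word_algebra C) ?S"
      unfolding gh G_mult[OF cp] by (rule R.Z_span_finsum[OF S])
  qed
qed

end
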